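(* Let $(E,\Vert\cdot\Vert)$ be a normed lattice that is an order dense majorizing vector sublattice of a vector lattice $G$, let $E^t$ with norm $\Vert\cdot\Vert_t$ be as defined in the context ($E\subseteq E^t\subseteq G$), and let $F$ be a Dedekind complete normed lattice. Let $0\le T\in\mathcal{L}_n(E,F)$ and let $T^t:E^t\to F$ be its extension described in the context. Then: 1. If $0\le x\in E^t$ and $\{x_\alpha\}\subseteq E^+$ is a net with $x_\alpha\downarrow x$, then $Tx_\alpha\downarrow T^tx$. 2. If $T(x\wedge y)=Tx\wedge Ty$ for all $0\le x,y\in E$, then $T^t$ is a lattice homomorphism from $E^t$ into $F$, and moreover $T^t\in\mathcal{L}_n(E^t,F)$. 3. If $0\le T:E\to E$ (the case $F=E$) is band preserving, then so is $T^t:E^t\to E^t$. 4. If $T:E\to F$ preserves disjointness, then so does $T^t$. 5. Let $E$ have order continuous norm. Then $\{Tx_n\}$ is norm convergent in $F$ for each positive increasing norm bounded sequence $\{x_n\}$ in $E$ if and only if $\{T^tx_n\}$ is norm convergent in $F$ for each positive increasing $\Vert\cdot\Vert_t$-bounded sequence $\{x_n\}$ in $E^t$.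
   Context: All vector lattices (Riesz spaces) are assumed Archimedean. $E^+$ is the set of positive elements of $E$. A vector sublattice $E$ of $G$ is majorizing in $G$ if for each $x\in G$ there is $y\in E$ with $x\le y$; it is order dense in $G$ if for each $0<x\in G$ there is $y\in E$ with $0<y\le x$. $E$ has order continuous norm if $\Vert x_\alpha\Vert\to 0$ for every decreasing net $(x_\alpha)$ in $E$ with $\inf_\alpha x_\alpha=0$. Definition of $E^t$: $E^t$ is a vector sublattice of $G$ with $E\subseteq E^t\subseteq G$ such that every $x\in E^t$ satisfies $$\inf\{\Vert y\Vert:\ y\in E^+,\ |x|\le y\}=\sup\{\Vert z\Vert:\ z\in E^+,\ z\le |x|\}.$$ The common value is denoted $\Vert x\Vert_t$; $(E^t,\Vert\cdot\Vert_t)$ is a normed lattice. ($E^t$ is not unique; the statement concerns any such $E^t$.) $\mathcal{L}_n(E,F)$ is the collection of order continuous linear operators from $E$ to $F$, i.e. those mapping order null nets to order null nets. Definition of $T^t$: for positive $T:E\to F$ let $p(x)=\inf\{Ty:\ y\in E,\ x\le y\}$ for $x\in E^t$; $T^t:E^t\to F$ is a linear extension of $T$ satisfying $T^tx\le p(x^+)$ for all $x\in E^t$. An operator $T:L\to L$ on a vector lattice is band preserving if $T(B)\subseteq B$ for every band $B$ of $L$. An operator $T:L\to M$ between vector lattices preserves disjointness if $x\perp y$ in $L$ implies $Tx\perp Ty$ in $M$. In part 3, $F=E$, and $T^t$ is regarded as a map into $E^t$ via $E\subseteq E^t$. *)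

theory Defs
  imports Complex_Main "HOL-Library.Lattice_Algebras" "HOL-Library.Lub_Glb"
begin

section \<open>Vector lattices, sublattices and normed lattices\<close>

text \<open>
  The ambient vector lattices are types of the following class; the vector lattices in which the
  theory takes place are carrier sets inside them.  All order notions (infimum, supremum,
  Dedekind completeness, order convergence, bands) are relative to the carrier \<open>L\<close>: in general
  an infinite infimum taken in \<open>L\<close> differs from the one taken in the ambient type.
\<close>

class vector_lattice = ordered_real_vector + lattice_ab_group_add_abs

instance real :: vector_lattice
  by standard (simp add: sup_real_def abs_real_def max_def)

definition vector_sublattice :: "'a::vector_lattice set \<Rightarrow> bool" where
  "vector_sublattice L \<longleftrightarrow>
     subspace L \<and> (\<forall>x\<in>L. \<forall>y\<in>L. sup x y \<in> L \<and> inf x y \<in> L)"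

definition archimedean_on :: "'a::vector_lattice set \<Rightarrow> bool" where
  "archimedean_on L \<longleftrightarrow>
     (\<forall>x\<in>L. \<forall>y\<in>L. (\<forall>n::nat. real n *\<^sub>R x \<le> y) \<longrightarrow> x \<le> 0)"

definition majorizing :: "'a::vector_lattice set \<Rightarrow> 'a set \<Rightarrow> bool" where
  "majorizing E G \<longleftrightarrow> (\<forall>x\<in>G. \<exists>y\<in>E. x \<le> y)"

definition order_dense :: "'a::vector_lattice set \<Rightarrow> 'a set \<Rightarrow> bool" where
  "order_dense E G \<longleftrightarrow> (\<forall>x\<in>G. 0 < x \<longrightarrow> (\<exists>y\<in>E. 0 < y \<and> y \<le> x))"

definition dedekind_complete_on :: "'a::vector_lattice set \<Rightarrow> bool" where
  "dedekind_complete_on L \<longleftrightarrow>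
     (\<forall>S. S \<subseteq> L \<and> S \<noteq> {} \<and> (\<exists>u. isUb L S u) \<longrightarrow> (\<exists>s. isLub L S s))"

text \<open>Only the values of the norm \<open>N\<close> on \<open>L\<close> matter.\<close>

definition normed_lattice :: "'a::vector_lattice set \<Rightarrow> ('a \<Rightarrow> real) \<Rightarrow> bool" where
  "normed_lattice L N \<longleftrightarrow>
     vector_sublattice L \<and>
     (\<forall>x\<in>L. 0 \<le> N x) \<and>
     (\<forall>x\<in>L. N x = 0 \<longleftrightarrow> x = 0) \<and>
     (\<forall>x\<in>L. \<forall>c. N (c *\<^sub>R x) = \<bar>c\<bar> * N x) \<and>
     (\<forall>x\<in>L. \<forall>y\<in>L. N (x + y) \<le> N x + N y) \<and>
     (\<forall>x\<in>L. \<forall>y\<in>L. \<bar>x\<bar> \<le> \<bar>y\<bar> \<longrightarrow> N x \<le> N y)"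

section \<open>Nets and order convergence\<close>

text \<open>
  A net is a family \<open>x\<close> over a directed set \<open>A\<close> with preorder \<open>r\<close>, where \<open>(a, b) \<in> r\<close>
  reads \<open>a \<le> b\<close>.
\<close>

definition directed_set :: "'i set \<Rightarrow> 'i rel \<Rightarrow> bool" where
  "directed_set A r \<longleftrightarrow>
     A \<noteq> {} \<and> preorder_on A r \<and> (\<forall>a\<in>A. \<forall>b\<in>A. \<exists>c\<in>A. (a, c) \<in> r \<and> (b, c) \<in> r)"

definition net_decreases_to ::
  "'a::vector_lattice set \<Rightarrow> 'i set \<Rightarrow> 'i rel \<Rightarrow> ('i \<Rightarrow> 'a) \<Rightarrow> 'a \<Rightarrow> bool" where
  "net_decreases_to L A r x l \<longleftrightarrow>
     directed_set A r \<and> (\<forall>a\<in>A. x a \<in> L) \<and>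
     (\<forall>a\<in>A. \<forall>b\<in>A. (a, b) \<in> r \<longrightarrow> x b \<le> x a) \<and> isGlb L (x ` A) l"

text \<open>
  Order null: eventually dominated by each term of a net decreasing to \<open>0\<close>, which may have
  another index set.  A definition cannot quantify over the type of that index set; index sets in
  the type of the lattice suffice, see \<open>order_nullI\<close> below.
\<close>

definition order_null ::
  "'a::vector_lattice set \<Rightarrow> 'i set \<Rightarrow> 'i rel \<Rightarrow> ('i \<Rightarrow> 'a) \<Rightarrow> bool" where
  "order_null L A r x \<longleftrightarrow>
     directed_set A r \<and> (\<forall>a\<in>A. x a \<in> L) \<and>
     (\<exists>(B :: 'a set) s y. net_decreases_to L B s y 0 \<and>
        (\<forall>b\<in>B. \<exists>a0\<in>A. \<forall>a\<in>A. (a0, a) \<in> r \<longrightarrow> \<bar>x a\<bar> \<le> y b))"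

definition order_continuous_norm :: "'a::vector_lattice set \<Rightarrow> ('a \<Rightarrow> real) \<Rightarrow> bool" where
  "order_continuous_norm L N \<longleftrightarrow>
     (\<forall>(A :: 'a set) r x. net_decreases_to L A r x 0 \<longrightarrow>
        (\<forall>\<epsilon>>0. \<exists>a0\<in>A. \<forall>a\<in>A. (a0, a) \<in> r \<longrightarrow> N (x a) < \<epsilon>))"

section \<open>Operators\<close>

definition linear_operator ::
  "'a::vector_lattice set \<Rightarrow> 'b::vector_lattice set \<Rightarrow> ('a \<Rightarrow> 'b) \<Rightarrow> bool" where
  "linear_operator L M T \<longleftrightarrow>
     (\<forall>x\<in>L. T x \<in> M) \<and>
     (\<forall>x\<in>L. \<forall>y\<in>L. T (x + y) = T x + T y) \<and>
     (\<forall>x\<in>L. \<forall>c. T (c *\<^sub>R x) = c *\<^sub>R T x)"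

definition positive_operator ::
  "'a::vector_lattice set \<Rightarrow> 'b::vector_lattice set \<Rightarrow> ('a \<Rightarrow> 'b) \<Rightarrow> bool" where
  "positive_operator L M T \<longleftrightarrow> linear_operator L M T \<and> (\<forall>x\<in>L. 0 \<le> x \<longrightarrow> 0 \<le> T x)"

text \<open>
  Again the type of the index sets has to be fixed.  The type \<open>'a set \<times> 'a\<close> is large enough for
  all nets, see \<open>order_continuous_operatorsD\<close> below.
\<close>

definition order_continuous_operators ::
  "'a::vector_lattice set \<Rightarrow> 'b::vector_lattice set \<Rightarrow> ('a \<Rightarrow> 'b) set" where
  "order_continuous_operators L M =
     {T. linear_operator L M T \<and>
         (\<forall>(A :: ('a set \<times> 'a) set) r x.
            order_null L A r x \<longrightarrow> order_null M A r (\<lambda>a. T (x a)))}"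

definition lattice_homomorphism ::
  "'a::vector_lattice set \<Rightarrow> 'b::vector_lattice set \<Rightarrow> ('a \<Rightarrow> 'b) \<Rightarrow> bool" where
  "lattice_homomorphism L M T \<longleftrightarrow> linear_operator L M T \<and>
     (\<forall>x\<in>L. \<forall>y\<in>L. T (sup x y) = sup (T x) (T y) \<and> T (inf x y) = inf (T x) (T y))"

definition disjoint_elements :: "'a::vector_lattice \<Rightarrow> 'a \<Rightarrow> bool" where
  "disjoint_elements x y \<longleftrightarrow> inf \<bar>x\<bar> \<bar>y\<bar> = 0"

definition preserves_disjointness ::
  "'a::vector_lattice set \<Rightarrow> ('a \<Rightarrow> 'b::vector_lattice) \<Rightarrow> bool" where
  "preserves_disjointness L T \<longleftrightarrow>
     (\<forall>x\<in>L. \<forall>y\<in>L. disjoint_elements x y \<longrightarrow> disjoint_elements (T x) (T y))"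

definition order_ideal :: "'a::vector_lattice set \<Rightarrow> 'a set \<Rightarrow> bool" where
  "order_ideal L B \<longleftrightarrow> B \<subseteq> L \<and> subspace B \<and> (\<forall>x\<in>L. \<forall>y\<in>B. \<bar>x\<bar> \<le> \<bar>y\<bar> \<longrightarrow> x \<in> B)"

definition band :: "'a::vector_lattice set \<Rightarrow> 'a set \<Rightarrow> bool" where
  "band L B \<longleftrightarrow> order_ideal L B \<and> (\<forall>D s. D \<subseteq> B \<and> isLub L D s \<longrightarrow> s \<in> B)"

definition band_preserving :: "'a::vector_lattice set \<Rightarrow> ('a \<Rightarrow> 'a) \<Rightarrow> bool" where
  "band_preserving L T \<longleftrightarrow> (\<forall>B. band L B \<longrightarrow> T ` B \<subseteq> B)"

section \<open>The extended lattice and the extended operator\<close>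

definition upper_norm :: "'a::vector_lattice set \<Rightarrow> ('a \<Rightarrow> real) \<Rightarrow> 'a \<Rightarrow> real" where
  "upper_norm E N x = Inf (N ` {y \<in> E. 0 \<le> y \<and> \<bar>x\<bar> \<le> y})"

definition lower_norm :: "'a::vector_lattice set \<Rightarrow> ('a \<Rightarrow> real) \<Rightarrow> 'a \<Rightarrow> real" where
  "lower_norm E N x = Sup (N ` {z \<in> E. 0 \<le> z \<and> z \<le> \<bar>x\<bar>})"

text \<open>
  The common value of \<open>upper_norm\<close> and \<open>lower_norm\<close> on \<open>Et\<close> is the norm of \<open>Et\<close>, for which
  \<open>upper_norm\<close> is used.  Several sets \<open>Et\<close> can satisfy the predicate.
\<close>

definition norm_extension_lattice ::
  "'a::vector_lattice set \<Rightarrow> ('a \<Rightarrow> real) \<Rightarrow> 'a set \<Rightarrow> 'a set \<Rightarrow> bool" where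
  "norm_extension_lattice E N G Et \<longleftrightarrow>
     vector_sublattice Et \<and> E \<subseteq> Et \<and> Et \<subseteq> G \<and>
     (\<forall>x\<in>Et. upper_norm E N x = lower_norm E N x)"

text \<open>
  \<open>majorant_map E F T x = inf {T y | y \<in> E, x \<le> y}\<close>, the infimum being taken in \<open>F\<close>.  It exists
  when \<open>E\<close> is majorizing, \<open>T\<close> positive and \<open>F\<close> Dedekind complete.
\<close>

definition majorant_map ::
  "'a::vector_lattice set \<Rightarrow> 'b::vector_lattice set \<Rightarrow> ('a \<Rightarrow> 'b) \<Rightarrow> 'a \<Rightarrow> 'b" where
  "majorant_map E F T x = (THE q. isGlb F (T ` {y \<in> E. x \<le> y}) q)"

definition operator_extension ::
  "'a::vector_lattice set \<Rightarrow> 'a set \<Rightarrow> 'b::vector_lattice set \<Rightarrow>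
    ('a \<Rightarrow> 'b) \<Rightarrow> ('a \<Rightarrow> 'b) \<Rightarrow> bool" where
  "operator_extension E Et F T Tt \<longleftrightarrow>
     linear_operator Et F Tt \<and> (\<forall>x\<in>E. Tt x = T x) \<and>
     (\<forall>x\<in>Et. Tt x \<le> majorant_map E F T (pprt x))"

section \<open>Independence of the types of the index sets\<close>

lemma net_decreases_to_range:
  fixes y :: "'j \<Rightarrow> 'a::vector_lattice"
  assumes "net_decreases_to L B s y l"
  shows "net_decreases_to L (y ` B) {(u, v) \<in> y ` B \<times> y ` B. v \<le> u} (\<lambda>u. u) l"
proof -
  have dir: "\<exists>c\<in>B. y c \<le> y a \<and> y c \<le> y b" if "a \<in> B" "b \<in> B" for a b
    using assms that unfolding net_decreases_to_def directed_set_def by meson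
  have ne: "B \<noteq> {}"
    using assms unfolding net_decreases_to_def directed_set_def by blast
  have "directed_set (y ` B) {(u, v) \<in> y ` B \<times> y ` B. v \<le> u}"
    unfolding directed_set_def preorder_on_def refl_on_def trans_def
    using ne dir by (auto intro: order_trans)
  with assms show ?thesis
    unfolding net_decreases_to_def by auto
qed

lemma order_nullI:
  fixes x :: "'i \<Rightarrow> 'a::vector_lattice" and y :: "'j \<Rightarrow> 'a"
  assumes "directed_set A r" "\<And>a. a \<in> A \<Longrightarrow> x a \<in> L" "net_decreases_to L B s y 0"
    and "\<And>b. b \<in> B \<Longrightarrow> \<exists>a0\<in>A. \<forall>a\<in>A. (a0, a) \<in> r \<longrightarrow> \<bar>x a\<bar> \<le> y b"
  shows "order_null L A r x"
  unfolding order_null_def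
  using assms(1,2,4) net_decreases_to_range[OF assms(3)] by fast

lemma order_continuous_normD:
  fixes x :: "'i \<Rightarrow> 'a::vector_lattice"
  assumes "order_continuous_norm L N" "net_decreases_to L A r x 0" "0 < \<epsilon>"
  shows "\<exists>a0\<in>A. \<forall>a\<in>A. (a0, a) \<in> r \<longrightarrow> N (x a) < \<epsilon>"
proof -
  obtain u where u: "u \<in> x ` A" "\<And>v. v \<in> x ` A \<Longrightarrow> v \<le> u \<Longrightarrow> N v < \<epsilon>"
    using assms(1,3) net_decreases_to_range[OF assms(2)]
    unfolding order_continuous_norm_def by fast
  then show ?thesis
    using assms(2) unfolding net_decreases_to_def by (metis imageE imageI)
qed

lemma order_continuous_operatorsD:
  fixes x :: "'i \<Rightarrow> 'a::vector_lattice" and T :: "'a \<Rightarrow> 'b::vector_lattice"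
  assumes T: "T \<in> order_continuous_operators L M" and x: "order_null L A r x"
  shows "order_null M A r (\<lambda>a. T (x a))"
proof -
  define tail where "tail a = x ` {b \<in> A. (a, b) \<in> r}" for a
  define A' where "A' = {(S, v). v \<in> S \<and> S \<in> tail ` A}"
  define r' where "r' = {(p, q) \<in> A' \<times> A'. fst q \<subseteq> fst p}"
  have d: "directed_set A r" and xL: "\<And>a. a \<in> A \<Longrightarrow> x a \<in> L"
    using x unfolding order_null_def by auto
  have refl: "(a, a) \<in> r" if "a \<in> A" for a
    using d that unfolding directed_set_def preorder_on_def refl_on_def by blast
  have tr: "(a, c) \<in> r" if "(a, b) \<in> r" "(b, c) \<in> r" for a b c
    using d that unfolding directed_set_def preorder_on_def trans_def by blast
  have mem: "x a \<in> tail a" if "a \<in> A" for a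
    using that refl unfolding tail_def by blast
  have mono: "tail b \<subseteq> tail a" if "(a, b) \<in> r" for a b
    using that tr unfolding tail_def by blast
  have d': "directed_set A' r'"
    unfolding directed_set_def
  proof (intro conjI ballI)
    show "A' \<noteq> {}"
      using d mem unfolding A'_def directed_set_def by blast
    show "preorder_on A' r'"
      unfolding preorder_on_def refl_on_def trans_def r'_def by auto
    fix p q assume "p \<in> A'" "q \<in> A'"
    then obtain a b where ab: "a \<in> A" "b \<in> A" "fst p = tail a" "fst q = tail b"
      unfolding A'_def by auto
    then obtain c where c: "c \<in> A" "(a, c) \<in> r" "(b, c) \<in> r"
      using d unfolding directed_set_def by blast
    have "(tail c, x c) \<in> A'"
      using c(1) mem unfolding A'_def by blast
    then show "\<exists>c\<in>A'. (p, c) \<in> r' \<and> (q, c) \<in> r'"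
      using \<open>p \<in> A'\<close> \<open>q \<in> A'\<close> ab mono[OF c(2)] mono[OF c(3)]
      unfolding r'_def by (intro bexI[of _ "(tail c, x c)"]) auto
  qed
  have tailL: "v \<in> L" if "v \<in> tail a" for a v
    using that xL unfolding tail_def by auto
  obtain B :: "'a set" and s y where y: "net_decreases_to L B s y 0"
    and dom: "\<And>b. b \<in> B \<Longrightarrow> \<exists>a0\<in>A. \<forall>a\<in>A. (a0, a) \<in> r \<longrightarrow> \<bar>x a\<bar> \<le> y b"
    using x unfolding order_null_def by blast
  have "order_null L A' r' snd"
  proof (rule order_nullI[OF d' _ y])
    show "snd p \<in> L" if "p \<in> A'" for p
      using that tailL unfolding A'_def by auto
    show "\<exists>p\<in>A'. \<forall>q\<in>A'. (p, q) \<in> r' \<longrightarrow> \<bar>snd q\<bar> \<le> y b" if "b \<in> B" for b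
    proof -
      obtain a0 where a0: "a0 \<in> A" "\<forall>a\<in>A. (a0, a) \<in> r \<longrightarrow> \<bar>x a\<bar> \<le> y b"
        using dom \<open>b \<in> B\<close> by blast
      then have "\<bar>v\<bar> \<le> y b" if "v \<in> tail a0" for v
        using that unfolding tail_def by auto
      moreover have "(tail a0, x a0) \<in> A'"
        using a0(1) mem unfolding A'_def by blast
      ultimately show ?thesis
        unfolding r'_def by (intro bexI[of _ "(tail a0, x a0)"]) (auto simp: A'_def)
    qed
  qed
  then have null': "order_null M A' r' (\<lambda>p. T (snd p))"
    using T unfolding order_continuous_operators_def by blast
  then obtain C :: "'b set" and t z where z: "net_decreases_to M C t z 0"
    and dom': "\<And>c. c \<in> C \<Longrightarrow> \<exists>p\<in>A'. \<forall>q\<in>A'. (p, q) \<in> r' \<longrightarrow> \<bar>T (snd q)\<bar> \<le> z c"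
    unfolding order_null_def by blast
  show ?thesis
  proof (rule order_nullI[OF d _ z])
    show "T (x a) \<in> M" if "a \<in> A" for a
      using T xL[OF that] unfolding order_continuous_operators_def linear_operator_def by blast
    show "\<exists>a0\<in>A. \<forall>a\<in>A. (a0, a) \<in> r \<longrightarrow> \<bar>T (x a)\<bar> \<le> z c" if "c \<in> C" for c
    proof -
      obtain p where p: "p \<in> A'" "\<forall>q\<in>A'. (p, q) \<in> r' \<longrightarrow> \<bar>T (snd q)\<bar> \<le> z c"
        using dom' \<open>c \<in> C\<close> by blast
      obtain a0 where a0: "a0 \<in> A" "fst p = tail a0"
        using p(1) unfolding A'_def by auto
      have "\<bar>T (x a)\<bar> \<le> z c" if "a \<in> A" "(a0, a) \<in> r" for a
      proof -
        have "x a \<in> tail a0"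
          using that unfolding tail_def by blast
        then have "(tail a0, x a) \<in> A'"
          using a0(1) unfolding A'_def by blast
        then have "(p, (tail a0, x a)) \<in> r'"
          using p(1) a0(2) unfolding r'_def by auto
        then show ?thesis
          using p(2) \<open>(tail a0, x a) \<in> A'\<close> by fastforce
      qed
      then show ?thesis
        using a0(1) by blast
    qed
  qed
qed

end

theory Submission
  imports Defs
begin

text \<open>
  An extension of \<open>T\<close> dominated by \<open>majorant_map\<close> is positive, because the majorant map
  vanishes at \<open>0\<close>.  Every element of \<open>E\<^sup>t\<close> is the supremum of the elements of \<open>E\<close> below it and the
  infimum of those above it; hence order continuity of \<open>T\<close> passes to \<open>T\<^sup>t\<close>, since a set decreasing
  to \<open>0\<close> in \<open>E\<^sup>t\<close> may be replaced by the set of its majorants in \<open>E\<close>.  Disjointness passes to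
  \<open>T\<^sup>t\<close> by \<open>T\<^sup>t x \<sqinter> T\<^sup>t y \<le> T z \<sqinter> T w + T\<^sup>t ((x - z) + (y - w))\<close>, where the last arguments decrease
  to \<open>0\<close>.  In part 3 a Dedekind complete \<open>E\<close> is already the whole space.  In part 5 the convergence
  condition on \<open>E\<close> forces \<open>T\<close> to be bounded, and then the terms of an increasing sequence in \<open>E\<^sup>t\<close> can
  be replaced by elements of \<open>E\<close> that are close in norm.
\<close>

section \<open>Vector sublattices and suprema\<close>

lemma isGlb_iff:
  "isGlb L S l \<longleftrightarrow> l \<in> L \<and> (\<forall>s\<in>S. l \<le> s) \<and> (\<forall>m\<in>L. (\<forall>s\<in>S. m \<le> s) \<longrightarrow> m \<le> l)"
  unfolding isGlb_def greatestP_def isLb_def setge_def setle_def by auto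

lemma isLub_iff:
  "isLub L S l \<longleftrightarrow> l \<in> L \<and> (\<forall>s\<in>S. s \<le> l) \<and> (\<forall>m\<in>L. (\<forall>s\<in>S. s \<le> m) \<longrightarrow> l \<le> m)"
  unfolding isLub_def leastP_def isUb_def setge_def setle_def by auto

lemma inf_diff_distrib:
  fixes a b c :: "'a::vector_lattice"
  shows "inf (a - c) (b - c) = inf a b - c"
  using add_inf_distrib_right[of a b "- c"] by simp

lemma inf_diff_inf:
  fixes a b :: "'a::vector_lattice"
  shows "inf (a - inf a b) (b - inf a b) = 0"
  by (simp only: inf_diff_distrib diff_self)

lemma vector_sublattice_closed:
  assumes "vector_sublattice L"
  shows "0 \<in> L"
    and "x \<in> L \<Longrightarrow> y \<in> L \<Longrightarrow> x + y \<in> L"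
    and "x \<in> L \<Longrightarrow> y \<in> L \<Longrightarrow> x - y \<in> L"
    and "x \<in> L \<Longrightarrow> - x \<in> L"
    and "x \<in> L \<Longrightarrow> c *\<^sub>R x \<in> L"
    and "x \<in> L \<Longrightarrow> y \<in> L \<Longrightarrow> sup x y \<in> L"
    and "x \<in> L \<Longrightarrow> y \<in> L \<Longrightarrow> inf x y \<in> L"
    and "x \<in> L \<Longrightarrow> \<bar>x\<bar> \<in> L"
  using assms subspace_neg[of L x]
  unfolding vector_sublattice_def abs_lattice
  by (auto intro: subspace_0 subspace_add subspace_diff subspace_neg subspace_scale)

lemma positive_operator_simps:
  assumes T: "positive_operator L M T" and L: "vector_sublattice L"
  shows "x \<in> L \<Longrightarrow> T x \<in> M"
    and "x \<in> L \<Longrightarrow> y \<in> L \<Longrightarrow> T (x + y) = T x + T y"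
    and "x \<in> L \<Longrightarrow> T (c *\<^sub>R x) = c *\<^sub>R T x"
    and "x \<in> L \<Longrightarrow> T (- x) = - T x"
    and "x \<in> L \<Longrightarrow> y \<in> L \<Longrightarrow> T (x - y) = T x - T y"
    and "T 0 = 0"
    and "x \<in> L \<Longrightarrow> 0 \<le> x \<Longrightarrow> 0 \<le> T x"
    and "x \<in> L \<Longrightarrow> y \<in> L \<Longrightarrow> x \<le> y \<Longrightarrow> T x \<le> T y"
    and "x \<in> L \<Longrightarrow> \<bar>T x\<bar> \<le> T \<bar>x\<bar>"
proof -
  show mem: "T x \<in> M" if "x \<in> L" for x
    using T that unfolding positive_operator_def linear_operator_def by blast
  show add: "T (x + y) = T x + T y" if "x \<in> L" "y \<in> L" for x y
    using T that unfolding positive_operator_def linear_operator_def by blast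
  show scale: "T (c *\<^sub>R x) = c *\<^sub>R T x" if "x \<in> L" for x c
    using T that unfolding positive_operator_def linear_operator_def by blast
  show minus: "T (- x) = - T x" if "x \<in> L" for x
    using scale[OF that, of "-1"] by simp
  show diff: "T (x - y) = T x - T y" if "x \<in> L" "y \<in> L" for x y
    using add[OF that(1) vector_sublattice_closed(4)[OF L that(2)]] minus[OF that(2)] by simp
  show "T 0 = 0"
    using scale[OF vector_sublattice_closed(1)[OF L], of 0] by simp
  show pos: "0 \<le> T x" if "x \<in> L" "0 \<le> x" for x
    using T that unfolding positive_operator_def by blast
  show mono: "T x \<le> T y" if "x \<in> L" "y \<in> L" "x \<le> y" for x y
    using pos[of "y - x"] diff[of y x] that vector_sublattice_closed(3)[OF L] by simp
  show "\<bar>T x\<bar> \<le> T \<bar>x\<bar>" if "x \<in> L"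
  proof (rule abs_leI)
    show "T x \<le> T \<bar>x\<bar>"
      using that vector_sublattice_closed(8)[OF L] by (intro mono) (auto simp: abs_ge_self)
    show "- T x \<le> T \<bar>x\<bar>"
      unfolding minus[OF that, symmetric]
      using that vector_sublattice_closed(4,8)[OF L] by (intro mono) (auto simp: abs_ge_minus_self)
  qed
qed

text \<open>For positive \<open>x\<close> the domination is applied to \<open>- x\<close>, whose
  positive part is \<open>0\<close>; this bounds \<open>- Tt x\<close> by the value of the majorant
  map at \<open>0\<close>.\<close>

lemma positive_operator_extension:
  assumes T: "positive_operator E F T" and E: "vector_sublattice E" and F: "vector_sublattice F"
    and Et: "vector_sublattice Et" and Tt: "operator_extension E Et F T Tt"
  shows "positive_operator Et F Tt"
proof -
  have lin: "linear_operator Et F Tt"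
    using Tt unfolding operator_extension_def by blast
  \<comment> \<open>The infimum is attained at \<open>y = 0\<close>, where \<open>T\<close>
    vanishes.\<close>
  have glb: "isGlb F (T ` {y \<in> E. 0 \<le> y}) 0"
    unfolding isGlb_iff
    using positive_operator_simps[OF T E] vector_sublattice_closed(1)[OF E]
      vector_sublattice_closed(1)[OF F] by force
  then have "majorant_map E F T 0 = 0"
    unfolding majorant_map_def by (rule the_equality) (use glb in \<open>auto simp: isGlb_iff intro: antisym\<close>)
  moreover have "0 \<le> Tt x" if "x \<in> Et" "0 \<le> x" for x
  proof -
    have "Tt (- x) \<le> majorant_map E F T (pprt (- x))"
      using Tt that vector_sublattice_closed(4)[OF Et] unfolding operator_extension_def by blast
    moreover have "pprt (- x) = 0"
      using that by simp
    moreover have "Tt (- x) = - Tt x"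
      using lin that unfolding linear_operator_def by (metis scaleR_minus1_left)
    ultimately show ?thesis
      using \<open>majorant_map E F T 0 = 0\<close> by simp
  qed
  ultimately show ?thesis
    using lin unfolding positive_operator_def by blast
qed

section \<open>Sets decreasing to zero\<close>

text \<open>A decreasing net matters here only through its range, so a downward directed set
  replaces it and no index type has to be carried along.\<close>

definition down_to_zero :: "'a::vector_lattice set \<Rightarrow> 'a set \<Rightarrow> bool" where
  "down_to_zero L D \<longleftrightarrow>
     D \<subseteq> L \<and> D \<noteq> {} \<and> (\<forall>a\<in>D. \<forall>b\<in>D. \<exists>c\<in>D. c \<le> a \<and> c \<le> b) \<and> isGlb L D 0"

lemma down_to_zero_net:
  assumes "down_to_zero L D"
  shows "net_decreases_to L D {(u, v) \<in> D \<times> D. v \<le> u} (\<lambda>u. u) 0"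
  using assms unfolding net_decreases_to_def directed_set_def preorder_on_def refl_on_def
    trans_def down_to_zero_def by (auto intro: order_trans)

lemma net_down_to_zero:
  assumes L: "vector_sublattice L" and net: "net_decreases_to L A r x l"
  shows "down_to_zero L ((\<lambda>a. x a - l) ` A)"
  unfolding down_to_zero_def
proof (intro conjI)
  have l: "l \<in> L" and ne: "A \<noteq> {}"
    using net unfolding net_decreases_to_def directed_set_def isGlb_iff by auto
  show "(\<lambda>a. x a - l) ` A \<subseteq> L"
    using net l vector_sublattice_closed(3)[OF L] unfolding net_decreases_to_def by auto
  show "(\<lambda>a. x a - l) ` A \<noteq> {}"
    using ne by simp
  show "\<forall>a\<in>(\<lambda>a. x a - l) ` A. \<forall>b\<in>(\<lambda>a. x a - l) ` A. \<exists>c\<in>(\<lambda>a. x a - l) ` A. c \<le> a \<and> c \<le> b"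
  proof clarsimp
    fix a b assume "a \<in> A" "b \<in> A"
    then obtain c where "c \<in> A" "(a, c) \<in> r" "(b, c) \<in> r"
      using net unfolding net_decreases_to_def directed_set_def by blast
    then show "\<exists>c\<in>A. x c \<le> x a \<and> x c \<le> x b"
      using net \<open>a \<in> A\<close> \<open>b \<in> A\<close> unfolding net_decreases_to_def by blast
  qed
  show "isGlb L ((\<lambda>a. x a - l) ` A) 0"
    unfolding isGlb_iff
  proof (intro conjI ballI impI)
    show "0 \<in> L"
      by (rule vector_sublattice_closed(1)[OF L])
    show "0 \<le> s" if "s \<in> (\<lambda>a. x a - l) ` A" for s
      using net that unfolding net_decreases_to_def isGlb_iff by auto
    fix m assume m: "m \<in> L" "\<forall>s\<in>(\<lambda>a. x a - l) ` A. m \<le> s"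
    then have "\<forall>a\<in>A. m + l \<le> x a" "m + l \<in> L"
      using l vector_sublattice_closed(2)[OF L] by (auto simp: le_diff_eq)
    then have "m + l \<le> l"
      using net unfolding net_decreases_to_def isGlb_iff by auto
    then show "m \<le> 0"
      by simp
  qed
qed

text \<open>If \<open>m\<close> is below every \<open>c + d\<close>, then \<open>m - d\<close> is a
  lower bound of \<open>C\<close> for each fixed \<open>d\<close>, so \<open>m \<le> d\<close>;
  varying \<open>d\<close> gives \<open>m \<le> 0\<close>.\<close>

lemma down_to_zero_add:
  assumes L: "vector_sublattice L" and C: "down_to_zero L C" and D: "down_to_zero L D"
  shows "down_to_zero L {c + d |c d. c \<in> C \<and> d \<in> D}"
  unfolding down_to_zero_def
proof (intro conjI)
  show "{c + d |c d. c \<in> C \<and> d \<in> D} \<subseteq> L"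
    using C D vector_sublattice_closed(2)[OF L] unfolding down_to_zero_def by blast
  show "{c + d |c d. c \<in> C \<and> d \<in> D} \<noteq> {}"
    using C D unfolding down_to_zero_def by blast
  show "\<forall>a\<in>{c + d |c d. c \<in> C \<and> d \<in> D}. \<forall>b\<in>{c + d |c d. c \<in> C \<and> d \<in> D}.
      \<exists>e\<in>{c + d |c d. c \<in> C \<and> d \<in> D}. e \<le> a \<and> e \<le> b"
  proof clarify
    fix c d c' d' assume *: "c \<in> C" "d \<in> D" "c' \<in> C" "d' \<in> D"
    obtain c'' where "c'' \<in> C" "c'' \<le> c" "c'' \<le> c'"
      using C * unfolding down_to_zero_def by blast
    moreover obtain d'' where "d'' \<in> D" "d'' \<le> d" "d'' \<le> d'"
      using D * unfolding down_to_zero_def by blast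
    ultimately show "\<exists>e\<in>{c + d |c d. c \<in> C \<and> d \<in> D}. e \<le> c + d \<and> e \<le> c' + d'"
      by (intro bexI[of _ "c'' + d''"]) (auto intro: add_mono)
  qed
  show "isGlb L {c + d |c d. c \<in> C \<and> d \<in> D} 0"
    unfolding isGlb_iff
  proof (intro conjI ballI impI)
    show "0 \<in> L"
      by (rule vector_sublattice_closed(1)[OF L])
    show "0 \<le> s" if "s \<in> {c + d |c d. c \<in> C \<and> d \<in> D}" for s
      using that C D unfolding down_to_zero_def isGlb_iff by auto
    fix m assume m: "m \<in> L" "\<forall>s\<in>{c + d |c d. c \<in> C \<and> d \<in> D}. m \<le> s"
    have "m \<le> d" if d: "d \<in> D" for d
    proof -
      have "m - d \<in> L"
        using m(1) d D vector_sublattice_closed(3)[OF L] unfolding down_to_zero_def by blast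
      moreover have "m - d \<le> c" if "c \<in> C" for c
        using m(2) that d by (auto simp: diff_le_eq)
      ultimately have "m - d \<le> 0"
        using C unfolding down_to_zero_def isGlb_iff by blast
      then show ?thesis
        by simp
    qed
    then show "m \<le> 0"
      using D m(1) unfolding down_to_zero_def isGlb_iff by blast
  qed
qed

text \<open>The identity net on \<open>D\<close> dominates itself and is therefore order null, so
  its image under \<open>T\<close> is dominated by some net \<open>y\<close> decreasing to
  \<open>0\<close> in \<open>M\<close>. Since \<open>f \<le> T a \<le> \<bar>T a\<bar>\<close>,
  \<open>f\<close> lies below every term of \<open>y\<close>.\<close>

lemma order_continuous_down_to_zero:
  assumes T: "T \<in> order_continuous_operators L M" and D: "down_to_zero L D"
    and f: "f \<in> M" "\<And>d. d \<in> D \<Longrightarrow> f \<le> T d"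
  shows "f \<le> 0"
proof -
  let ?r = "{(u, v) \<in> D \<times> D. v \<le> u}"
  have net: "net_decreases_to L D ?r (\<lambda>u. u) 0"
    by (rule down_to_zero_net[OF D])
  have "order_null L D ?r (\<lambda>u. u)"
  proof (rule order_nullI[OF _ _ net])
    show "directed_set D ?r"
      using net unfolding net_decreases_to_def by blast
    show "a \<in> L" if "a \<in> D" for a
      using that D unfolding down_to_zero_def by blast
    show "\<exists>a0\<in>D. \<forall>a\<in>D. (a0, a) \<in> ?r \<longrightarrow> \<bar>a\<bar> \<le> b" if "b \<in> D" for b
      using that D unfolding down_to_zero_def isGlb_iff by (intro bexI[of _ b]) auto
  qed
  then have "order_null M D ?r T"
    using order_continuous_operatorsD[OF T] by blast
  then obtain B :: "'b set" and s y where y: "net_decreases_to M B s y 0"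
    and dom: "\<And>b. b \<in> B \<Longrightarrow> \<exists>a0\<in>D. \<forall>a\<in>D. (a0, a) \<in> ?r \<longrightarrow> \<bar>T a\<bar> \<le> y b"
    unfolding order_null_def by blast
  have "f \<le> y b" if b: "b \<in> B" for b
  proof -
    obtain a where a: "a \<in> D" "\<bar>T a\<bar> \<le> y b"
      using dom[OF b] by blast
    have "f \<le> T a" "T a \<le> \<bar>T a\<bar>"
      using f(2) a(1) abs_ge_self by auto
    then show ?thesis
      using a(2) by (meson order_trans)
  qed
  then show ?thesis
    using y f(1) unfolding net_decreases_to_def isGlb_iff by blast
qed

section \<open>Order dense majorizing sublattices\<close>

locale dense_majorizing =
  fixes E :: "'a::vector_lattice set"
  assumes arch: "archimedean_on (UNIV :: 'a set)"
    and E: "vector_sublattice E"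
    and dense: "order_dense E UNIV"
    and major: "majorizing E UNIV"
begin

text \<open>Otherwise order density puts some \<open>e > 0\<close> of \<open>E\<close> below the gap
  \<open>x - inf x u\<close>, and all multiples of \<open>e\<close> stay below \<open>x\<close>,
  against the Archimedean property.\<close>

lemma le_if_lower_positive:
  assumes x: "0 \<le> x" and u: "\<And>z. z \<in> E \<Longrightarrow> 0 \<le> z \<Longrightarrow> z \<le> x \<Longrightarrow> z \<le> u"
  shows "x \<le> u"
proof (rule ccontr)
  assume "\<not> x \<le> u"
  then have "inf x u \<noteq> x"
    by (metis inf.cobounded2)
  then have "inf x u < x"
    by (simp add: less_le)
  then have "0 < x - inf x u"
    by (simp only: diff_gt_0_iff_gt)
  then obtain e where e: "e \<in> E" "0 < e" "e \<le> x - inf x u"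
    using dense unfolding order_dense_def by blast
  \<comment> \<open>The multiple \<open>real n *\<^sub>R e\<close> lies in \<open>E\<close> below
    \<open>x\<close>, hence below \<open>u\<close> by hypothesis and so below
    \<open>inf x u\<close>; one more \<open>e\<close> fits into the gap up to
    \<open>x\<close>.\<close>
  have "real n *\<^sub>R e \<in> E \<and> 0 \<le> real n *\<^sub>R e \<and> real n *\<^sub>R e \<le> x" for n
  proof (induction n)
    case 0
    then show ?case
      using x vector_sublattice_closed(1)[OF E] by simp
  next
    case (Suc n)
    then have "real n *\<^sub>R e \<le> inf x u"
      using u by auto
    then have "real n *\<^sub>R e + e \<le> inf x u + (x - inf x u)"
      using e(3) by (rule add_mono)
    moreover have "real (Suc n) *\<^sub>R e = real n *\<^sub>R e + e"
      by (simp add: scaleR_left_distrib)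
    moreover have "0 \<le> real n *\<^sub>R e + e"
      using Suc e(2) by (intro add_nonneg_nonneg) auto
    moreover have "real n *\<^sub>R e + e \<in> E"
      using Suc e(1) vector_sublattice_closed(2)[OF E] by blast
    ultimately show ?case
      by (simp only: add_diff_cancel_left' add_diff_eq)
  qed
  then have "e \<le> 0"
    using arch unfolding archimedean_on_def by blast
  then show False
    using e(2) by simp
qed

text \<open>Reflection in a majorant \<open>w\<close> from \<open>E\<close>: the elements
  \<open>z\<close> of \<open>E\<close> between \<open>0\<close> and \<open>w - x\<close> yield the
  majorants \<open>w - z\<close> of \<open>x\<close>, so approximation from below applies to
  \<open>w - x\<close>.\<close>

lemma le_if_upper:
  assumes u: "\<And>y. y \<in> E \<Longrightarrow> x \<le> y \<Longrightarrow> u \<le> y"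
  shows "u \<le> x"
proof -
  obtain w where w: "w \<in> E" "x \<le> w"
    using major unfolding majorizing_def by blast
  have "w - x \<le> w - u"
  proof (rule le_if_lower_positive)
    show "0 \<le> w - x"
      using w(2) by simp
    fix z assume z: "z \<in> E" "0 \<le> z" "z \<le> w - x"
    then have "u \<le> w - z"
      using w(1) vector_sublattice_closed(3)[OF E] by (intro u) (auto simp: algebra_simps)
    then show "z \<le> w - u"
      by (simp add: algebra_simps)
  qed
  then show ?thesis
    by simp
qed

text \<open>The supremum in \<open>E\<close> of the elements of \<open>E\<close> below
  \<open>x\<close> exists by completeness, and approximation from both sides identifies it with
  \<open>x\<close> itself.\<close>

lemma dedekind_complete_imp_UNIV:
  assumes "dedekind_complete_on E"
  shows "E = UNIV"
proof -
  have "x \<in> E" for x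
  proof -
    define S where "S = {z \<in> E. z \<le> x}"
    \<comment> \<open>As \<open>x\<close> need not be positive, approximation from below is obtained
      by applying \<open>le_if_upper\<close> to \<open>- x\<close>.\<close>
    have lower: "x \<le> v" if "\<And>z. z \<in> S \<Longrightarrow> z \<le> v" for v
    proof -
      have "- v \<le> - x"
      proof (rule le_if_upper)
        fix y assume "y \<in> E" "- x \<le> y"
        then have "- y \<in> S"
          using vector_sublattice_closed(4)[OF E] minus_le_iff unfolding S_def by blast
        then show "- v \<le> y"
          using that minus_le_iff by blast
      qed
      then show ?thesis
        by simp
    qed
    obtain w where w: "w \<in> E" "x \<le> w"
      using major unfolding majorizing_def by blast
    obtain v where v: "v \<in> E" "- x \<le> v"
      using major unfolding majorizing_def by blast
    have "S \<subseteq> E"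
      unfolding S_def by blast
    moreover have "- v \<in> S"
      using v vector_sublattice_closed(4)[OF E] minus_le_iff unfolding S_def by blast
    moreover have "isUb E S w"
      using w unfolding S_def isUb_def setle_def by (auto intro: order_trans)
    ultimately obtain s where s: "isLub E S s"
      using assms unfolding dedekind_complete_on_def by (metis empty_iff)
    have "x \<le> s"
      using s unfolding isLub_iff by (intro lower) auto
    moreover have "s \<le> x"
    proof (rule le_if_upper)
      fix y assume y: "y \<in> E" "x \<le> y"
      then have "\<forall>z\<in>S. z \<le> y"
        unfolding S_def by (auto intro: order_trans)
      then show "s \<le> y"
        using s y(1) unfolding isLub_iff by blast
    qed
    ultimately show ?thesis
      using s unfolding isLub_iff by auto
  qed
  then show ?thesis
    by blast
qed

section \<open>Sets of gaps and of majorants that decrease to zero\<close>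

lemma gap_down_to_zero:
  assumes x: "0 \<le> x"
  shows "down_to_zero E {y - z |y z. y \<in> E \<and> z \<in> E \<and> x \<le> y \<and> 0 \<le> z \<and> z \<le> x}"
    (is "down_to_zero E ?D")
  unfolding down_to_zero_def
proof (intro conjI)
  obtain w where w: "w \<in> E" "x \<le> w"
    using major unfolding majorizing_def by blast
  show "?D \<subseteq> E"
    using vector_sublattice_closed(3)[OF E] by blast
  show "?D \<noteq> {}"
    using w x vector_sublattice_closed(1)[OF E] by blast
  show "\<forall>a\<in>?D. \<forall>b\<in>?D. \<exists>c\<in>?D. c \<le> a \<and> c \<le> b"
  proof clarify
    fix y z y' z'
    assume *: "y \<in> E" "z \<in> E" "x \<le> y" "0 \<le> z" "z \<le> x"
      "y' \<in> E" "z' \<in> E" "x \<le> y'" "0 \<le> z'" "z' \<le> x"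
    then have "inf y y' - sup z z' \<in> ?D"
      using vector_sublattice_closed(6,7)[OF E] by (blast intro: le_infI le_supI le_supI1)
    then show "\<exists>c\<in>?D. c \<le> y - z \<and> c \<le> y' - z'"
      by (rule bexI[rotated]) (intro conjI diff_mono inf_le1 inf_le2 sup_ge1 sup_ge2)
  qed
  show "isGlb E ?D 0"
    unfolding isGlb_iff
  proof (intro conjI ballI impI)
    show "0 \<in> E"
      by (rule vector_sublattice_closed(1)[OF E])
    show "0 \<le> s" if "s \<in> ?D" for s
      using that by (auto intro: order_trans)
    fix m assume m: "m \<in> E" "\<forall>s\<in>?D. m \<le> s"
    \<comment> \<open>For fixed \<open>z\<close>, the bound \<open>m + z \<le> y\<close> for all
      majorants \<open>y\<close> gives \<open>m + z \<le> x\<close>. Then all such \<open>z\<close>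
      lie below \<open>x - m\<close>, hence so does \<open>x\<close>.\<close>
    have "x \<le> x - m"
    proof (rule le_if_lower_positive[OF x])
      fix z assume z: "z \<in> E" "0 \<le> z" "z \<le> x"
      have "m + z \<le> x"
      proof (rule le_if_upper)
        fix y assume "y \<in> E" "x \<le> y"
        then have "m \<le> y - z"
          using m(2) z by blast
        then show "m + z \<le> y"
          by (simp add: le_diff_eq)
      qed
      then show "z \<le> x - m"
        by (simp add: algebra_simps)
    qed
    then show "m \<le> 0"
      by simp
  qed
qed

text \<open>The differences \<open>x - z\<close> need not lie in \<open>E\<close>, so the infimum is
  taken in a lattice \<open>L\<close> that contains both \<open>E\<close> and \<open>x\<close>. A
  lower bound \<open>m\<close> puts every \<open>z\<close> below \<open>x - m\<close>, and hence
  \<open>x\<close> too.\<close>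

lemma lower_gap_down_to_zero:
  assumes x: "x \<in> L" "0 \<le> x" and L: "vector_sublattice L" "E \<subseteq> L"
  shows "down_to_zero L {x - z |z. z \<in> E \<and> 0 \<le> z \<and> z \<le> x}" (is "down_to_zero L ?D")
  unfolding down_to_zero_def
proof (intro conjI)
  show "?D \<subseteq> L"
    using vector_sublattice_closed(3)[OF L(1)] x(1) L(2) by blast
  show "?D \<noteq> {}"
    using x vector_sublattice_closed(1)[OF E] by blast
  show "\<forall>a\<in>?D. \<forall>b\<in>?D. \<exists>c\<in>?D. c \<le> a \<and> c \<le> b"
  proof clarify
    fix z z' assume *: "z \<in> E" "0 \<le> z" "z \<le> x" "z' \<in> E" "0 \<le> z'" "z' \<le> x"
    then have "x - sup z z' \<in> ?D"
      using vector_sublattice_closed(6)[OF E] by (blast intro: le_supI le_supI1)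
    then show "\<exists>c\<in>?D. c \<le> x - z \<and> c \<le> x - z'"
      by (rule bexI[rotated]) (auto intro: diff_mono)
  qed
  show "isGlb L ?D 0"
    unfolding isGlb_iff
  proof (intro conjI ballI impI)
    show "0 \<in> L"
      by (rule vector_sublattice_closed(1)[OF L(1)])
    show "0 \<le> s" if "s \<in> ?D" for s
      using that by auto
    fix m assume m: "m \<in> L" "\<forall>s\<in>?D. m \<le> s"
    have "x \<le> x - m"
    proof (rule le_if_lower_positive[OF x(2)])
      fix z assume "z \<in> E" "0 \<le> z" "z \<le> x"
      then have "m \<le> x - z"
        using m(2) by blast
      then show "z \<le> x - m"
        by (simp add: algebra_simps)
    qed
    then show "m \<le> 0"
      by simp
  qed
qed

text \<open>This carries a set of the larger lattice back into \<open>E\<close>, where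
  \<open>T\<close> is known to be order continuous. A lower bound of all majorants in
  \<open>E\<close> is below each \<open>d\<close> by \<open>le_if_upper\<close>.\<close>

lemma majorants_down_to_zero:
  assumes D: "down_to_zero L D" and L: "E \<subseteq> L"
  shows "down_to_zero E {y \<in> E. \<exists>d\<in>D. d \<le> y}" (is "down_to_zero E ?D")
  unfolding down_to_zero_def
proof (intro conjI)
  show "?D \<subseteq> E"
    by blast
  show "?D \<noteq> {}"
    using D major unfolding down_to_zero_def majorizing_def by blast
  show "\<forall>a\<in>?D. \<forall>b\<in>?D. \<exists>c\<in>?D. c \<le> a \<and> c \<le> b"
  proof clarify
    fix y d y' d' assume *: "y \<in> E" "d \<in> D" "d \<le> y" "y' \<in> E" "d' \<in> D" "d' \<le> y'"
    obtain d'' where "d'' \<in> D" "d'' \<le> d" "d'' \<le> d'"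
      using D * unfolding down_to_zero_def by blast
    then have "inf y y' \<in> ?D"
      using * vector_sublattice_closed(7)[OF E] by (auto intro: order_trans)
    then show "\<exists>c\<in>?D. c \<le> y \<and> c \<le> y'"
      by (rule bexI[rotated]) auto
  qed
  show "isGlb E ?D 0"
    unfolding isGlb_iff
  proof (intro conjI ballI impI)
    show "0 \<in> E"
      by (rule vector_sublattice_closed(1)[OF E])
    show "0 \<le> s" if "s \<in> ?D" for s
      using that D unfolding down_to_zero_def isGlb_iff by (auto intro: order_trans)
    fix m assume m: "m \<in> E" "\<forall>s\<in>?D. m \<le> s"
    have "m \<le> d" if d: "d \<in> D" for d
    proof (rule le_if_upper)
      show "m \<le> y" if "y \<in> E" "d \<le> y" for y
        using m(2) d that by blast
    qed
    then show "m \<le> 0"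
      using D L m(1) unfolding down_to_zero_def isGlb_iff by blast
  qed
qed

end

section \<open>The extended operator\<close>

text \<open>The domination by \<open>majorant_map\<close> enters through the positivity of
  \<open>Tt\<close>, which \<open>positive_operator_extension\<close> supplies.\<close>

locale positive_extension = dense_majorizing E
  for E :: "'a::vector_lattice set" +
  fixes Et :: "'a set" and F :: "'b::vector_lattice set" and T Tt :: "'a \<Rightarrow> 'b"
  assumes Et: "vector_sublattice Et" and F: "vector_sublattice F" and E_sub: "E \<subseteq> Et"
    and T_oc: "T \<in> order_continuous_operators E F"
    and Tt_pos: "positive_operator Et F Tt"
    and ext: "\<And>x. x \<in> E \<Longrightarrow> Tt x = T x"
begin

section \<open>Order continuity of the extension\<close>

lemmas Tt_simps = positive_operator_simps[OF Tt_pos Et]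
lemmas Et_closed = vector_sublattice_closed[OF Et]
lemmas F_closed = vector_sublattice_closed[OF F]

text \<open>If \<open>y\<close> in \<open>E\<close> majorizes some \<open>d\<close>, then
  \<open>f \<le> Tt d \<le> Tt y = T y\<close>; these majorants decrease to zero in
  \<open>E\<close>, so order continuity of \<open>T\<close> applies.\<close>

lemma extension_down_to_zero:
  assumes D: "down_to_zero Et D" and f: "f \<in> F" "\<And>d. d \<in> D \<Longrightarrow> f \<le> Tt d"
  shows "f \<le> 0"
proof (rule order_continuous_down_to_zero[OF T_oc majorants_down_to_zero[OF D E_sub] f(1)])
  fix y assume "y \<in> {y \<in> E. \<exists>d\<in>D. d \<le> y}"
  then obtain d where d: "y \<in> E" "d \<in> D" "d \<le> y"
    by blast
  then have "f \<le> Tt d" "Tt d \<le> Tt y"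
    using f(2) D E_sub unfolding down_to_zero_def by (auto intro: Tt_simps(8))
  then show "f \<le> T y"
    using ext[OF d(1)] by simp
qed

text \<open>Translation by \<open>l\<close> turns a lower bound \<open>m\<close> of the images into
  the lower bound \<open>m - Tt l\<close> of \<open>Tt\<close> on a set decreasing to zero.\<close>

lemma extension_net_decreases:
  assumes net: "net_decreases_to Et A r x l"
  shows "net_decreases_to F A r (\<lambda>a. Tt (x a)) (Tt l)"
  unfolding net_decreases_to_def
proof (intro conjI ballI impI)
  have x: "x a \<in> Et" "l \<le> x a" if "a \<in> A" for a
    using net that unfolding net_decreases_to_def isGlb_iff by auto
  have l: "l \<in> Et"
    using net unfolding net_decreases_to_def isGlb_iff by auto
  show "directed_set A r"
    using net unfolding net_decreases_to_def by blast
  show "Tt (x a) \<in> F" if "a \<in> A" for a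
    using x that Tt_simps(1) by blast
  show "Tt (x b) \<le> Tt (x a)" if "a \<in> A" "b \<in> A" "(a, b) \<in> r" for a b
    using net that x(1) unfolding net_decreases_to_def by (intro Tt_simps(8)) auto
  show "isGlb F ((\<lambda>a. Tt (x a)) ` A) (Tt l)"
    unfolding isGlb_iff
  proof (intro conjI ballI impI)
    show "Tt l \<in> F"
      using l Tt_simps(1) by blast
    show "Tt l \<le> s" if "s \<in> (\<lambda>a. Tt (x a)) ` A" for s
      using that x l Tt_simps(8) by auto
    fix m assume m: "m \<in> F" "\<forall>s\<in>(\<lambda>a. Tt (x a)) ` A. m \<le> s"
    have "m - Tt l \<le> 0"
    proof (rule extension_down_to_zero[OF net_down_to_zero[OF Et net]])
      show "m - Tt l \<in> F"
        using m(1) l Tt_simps(1) F_closed(3) by blast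
      show "m - Tt l \<le> Tt d" if "d \<in> (\<lambda>a. x a - l) ` A" for d
        using that m(2) x(1) l by (auto simp: Tt_simps(5) intro: diff_right_mono)
    qed
    then show "m \<le> Tt l"
      by simp
  qed
qed

text \<open>By positivity
  \<open>\<bar>Tt (x a)\<bar> \<le> Tt \<bar>x a\<bar> \<le> Tt (y b)\<close>, so the image of the
  dominating net dominates the image net.\<close>

lemma extension_order_continuous: "Tt \<in> order_continuous_operators Et F"
proof -
  have "order_null F A r (\<lambda>a. Tt (x a))" if null: "order_null Et A r x"
    for A :: "('a set \<times> 'a) set" and r x
  proof -
    obtain B :: "'a set" and s y where y: "net_decreases_to Et B s y 0"
      and dom: "\<And>b. b \<in> B \<Longrightarrow> \<exists>a0\<in>A. \<forall>a\<in>A. (a0, a) \<in> r \<longrightarrow> \<bar>x a\<bar> \<le> y b"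
      using null unfolding order_null_def by blast
    have x: "x a \<in> Et" if "a \<in> A" for a
      using null that unfolding order_null_def by blast
    have Ty: "net_decreases_to F B s (\<lambda>b. Tt (y b)) 0"
      using extension_net_decreases[OF y] Tt_simps(6) by simp
    show ?thesis
    proof (rule order_nullI[OF _ _ Ty])
      show "directed_set A r"
        using null unfolding order_null_def by blast
      show "Tt (x a) \<in> F" if "a \<in> A" for a
        using x[OF that] Tt_simps(1) by blast
      show "\<exists>a0\<in>A. \<forall>a\<in>A. (a0, a) \<in> r \<longrightarrow> \<bar>Tt (x a)\<bar> \<le> Tt (y b)" if b: "b \<in> B" for b
      proof -
        have yb: "y b \<in> Et"
          using y b unfolding net_decreases_to_def by blast
        have "\<bar>Tt (x a)\<bar> \<le> Tt (y b)" if "a \<in> A" "\<bar>x a\<bar> \<le> y b" for a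
          using Tt_simps(9)[OF x[OF that(1)]]
            Tt_simps(8)[OF Et_closed(8)[OF x[OF that(1)]] yb that(2)] by (rule order_trans)
        then show ?thesis
          using dom[OF b] by blast
      qed
    qed
  qed
  then show ?thesis
    using Tt_pos unfolding order_continuous_operators_def positive_operator_def by blast
qed

section \<open>Disjointness and lattice homomorphisms\<close>

lemma extension_disjoint_positive:
  assumes disj: "\<And>z w. z \<in> E \<Longrightarrow> w \<in> E \<Longrightarrow> 0 \<le> z \<Longrightarrow> 0 \<le> w \<Longrightarrow> inf z w = 0 \<Longrightarrow> inf (T z) (T w) = 0"
    and x: "x \<in> Et" "0 \<le> x" and y: "y \<in> Et" "0 \<le> y" and xy: "inf x y = 0"
  shows "inf (Tt x) (Tt y) = 0"
proof (rule antisym)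
  show "0 \<le> inf (Tt x) (Tt y)"
    using x y Tt_simps(7) by simp
  let ?C = "{x - z |z. z \<in> E \<and> 0 \<le> z \<and> z \<le> x}" and ?D = "{y - z |z. z \<in> E \<and> 0 \<le> z \<and> z \<le> y}"
  have down: "down_to_zero Et {c + d |c d. c \<in> ?C \<and> d \<in> ?D}"
    by (intro down_to_zero_add Et lower_gap_down_to_zero x y E_sub)
  show "inf (Tt x) (Tt y) \<le> 0"
  proof (rule extension_down_to_zero[OF down])
    show "inf (Tt x) (Tt y) \<in> F"
      using x y Tt_simps(1) F_closed(7) by blast
    fix e assume "e \<in> {c + d |c d. c \<in> ?C \<and> d \<in> ?D}"
    then obtain z w where z: "z \<in> E" "0 \<le> z" "z \<le> x" and w: "w \<in> E" "0 \<le> w" "w \<le> y"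
      and e: "e = (x - z) + (y - w)"
      by blast
    have zw: "z \<in> Et" "w \<in> Et"
      using z w E_sub by auto
    define c where "c = Tt (x - z)"
    define d where "d = Tt (y - w)"
    have cd: "0 \<le> c" "0 \<le> d"
      unfolding c_def d_def using x y z w zw Et_closed(3) Tt_simps(7) by auto
    have e': "Tt e = c + d"
      unfolding e c_def d_def using x y zw Et_closed(3) Tt_simps(2) by blast
    \<comment> \<open>Disjointness passes to smaller positive elements, so the hypothesis on
      \<open>E\<close> applies to \<open>z\<close> and \<open>w\<close>.\<close>
    have "inf z w \<le> inf x y"
      using z(3) w(3) by (rule inf_mono)
    then have "inf z w = 0"
      using xy z(2) w(2) by (intro antisym) auto
    then have inf0: "inf (Tt z) (Tt w) = 0"
      using disj z w ext by simp
    have "Tt x = Tt z + c" "Tt y = Tt w + d"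
      unfolding c_def d_def using x y zw by (auto simp: Tt_simps(5))
    \<comment> \<open>Enlarging both errors to \<open>c + d\<close> makes them a common shift that
      can be pulled out of the infimum.\<close>
    then have "inf (Tt x) (Tt y) \<le> inf (Tt z + (c + d)) (Tt w + (c + d))"
      using cd by (intro inf_mono) auto
    also have "\<dots> = Tt e"
      using inf0 e' by (simp add: add_inf_distrib_right[symmetric])
    finally show "inf (Tt x) (Tt y) \<le> Tt e" .
  qed
qed

text \<open>The estimate \<open>\<bar>Tt x\<bar> \<le> Tt \<bar>x\<bar>\<close> reduces the claim to
  positive elements.\<close>

lemma extension_preserves_disjointness:
  assumes disj: "preserves_disjointness E T"
  shows "preserves_disjointness Et Tt"
proof -
  have T_pos: "T z = \<bar>T z\<bar>" if "z \<in> E" "0 \<le> z" for z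
    using that Tt_simps(7)[of z] ext E_sub by auto
  have pos: "inf (T z) (T w) = 0" if "z \<in> E" "w \<in> E" "0 \<le> z" "0 \<le> w" "inf z w = 0" for z w
  proof -
    have "inf \<bar>z\<bar> \<bar>w\<bar> = 0"
      using that by simp
    then have "inf \<bar>T z\<bar> \<bar>T w\<bar> = 0"
      using disj that unfolding preserves_disjointness_def disjoint_elements_def by blast
    then show ?thesis
      using that T_pos by metis
  qed
  have "inf \<bar>Tt x\<bar> \<bar>Tt y\<bar> = 0" if "x \<in> Et" "y \<in> Et" "inf \<bar>x\<bar> \<bar>y\<bar> = 0" for x y
  proof (rule antisym)
    have "inf \<bar>Tt x\<bar> \<bar>Tt y\<bar> \<le> inf (Tt \<bar>x\<bar>) (Tt \<bar>y\<bar>)"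
      using that Tt_simps(9) by (intro inf_mono) auto
    also have "\<dots> = 0"
      using that Et_closed(8) by (intro extension_disjoint_positive pos) auto
    finally show "inf \<bar>Tt x\<bar> \<bar>Tt y\<bar> \<le> 0" .
  qed auto
  then show ?thesis
    unfolding preserves_disjointness_def disjoint_elements_def by blast
qed

text \<open>Subtracting \<open>inf x y\<close> from both \<open>x\<close> and \<open>y\<close>
  leaves disjoint positive elements, so a hypothesis on positive elements of \<open>E\<close>
  reaches arbitrary \<open>x\<close> and \<open>y\<close> of \<open>Et\<close>.\<close>

lemma extension_lattice_homomorphism:
  assumes hom: "\<And>x y. x \<in> E \<Longrightarrow> y \<in> E \<Longrightarrow> 0 \<le> x \<Longrightarrow> 0 \<le> y \<Longrightarrow> T (inf x y) = inf (T x) (T y)"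
  shows "lattice_homomorphism Et F Tt"
proof -
  have T0: "T 0 = 0"
    using ext[OF vector_sublattice_closed(1)[OF E]] Tt_simps(6) by simp
  have inf: "Tt (inf x y) = inf (Tt x) (Tt y)" if x: "x \<in> Et" and y: "y \<in> Et" for x y
  proof -
    let ?i = "inf x y"
    have i: "?i \<in> Et"
      using x y Et_closed(7) by blast
    have "inf (x - ?i) (y - ?i) = 0"
      by (rule inf_diff_inf)
    moreover have "inf (T z) (T w) = 0"
      if "z \<in> E" "w \<in> E" "0 \<le> z" "0 \<le> w" "inf z w = 0" for z w
      using hom[OF that(1-4)] that(5) T0 by simp
    moreover have "0 \<le> x - ?i" "0 \<le> y - ?i"
      by (simp_all only: diff_ge_0_iff_ge inf_le1 inf_le2)
    ultimately have "inf (Tt (x - ?i)) (Tt (y - ?i)) = 0"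
      using x y i Et_closed(3) extension_disjoint_positive by metis
    then have "inf (Tt x - Tt ?i) (Tt y - Tt ?i) = 0"
      by (simp only: Tt_simps(5)[OF x i] Tt_simps(5)[OF y i])
    then have "inf (Tt x) (Tt y) - Tt ?i = 0"
      by (simp only: inf_diff_distrib)
    then show ?thesis
      by simp
  qed
  moreover have "Tt (sup x y) = sup (Tt x) (Tt y)" if x: "x \<in> Et" and y: "y \<in> Et" for x y
  proof -
    \<comment> \<open>Suprema follow from infima, since supremum and infimum add up to
      \<open>x + y\<close>.\<close>
    have "Tt (sup x y) + Tt (inf x y) = Tt x + Tt y"
      using add_eq_inf_sup[of x y] Tt_simps(2) x y Et_closed(6,7) by metis
    then have "Tt (sup x y) + inf (Tt x) (Tt y) = sup (Tt x) (Tt y) + inf (Tt x) (Tt y)"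
      unfolding inf[OF x y] by (simp only: add_eq_inf_sup[of "Tt x" "Tt y"])
    then show ?thesis
      by (simp only: add_right_cancel)
  qed
  ultimately show ?thesis
    using Tt_pos unfolding lattice_homomorphism_def positive_operator_def by blast
qed

end

section \<open>Norms\<close>

lemma normed_latticeD:
  assumes "normed_lattice L N"
  shows "vector_sublattice L"
    and "x \<in> L \<Longrightarrow> 0 \<le> N x"
    and "x \<in> L \<Longrightarrow> N (c *\<^sub>R x) = \<bar>c\<bar> * N x"
    and "x \<in> L \<Longrightarrow> y \<in> L \<Longrightarrow> N (x + y) \<le> N x + N y"
    and "x \<in> L \<Longrightarrow> y \<in> L \<Longrightarrow> 0 \<le> x \<Longrightarrow> x \<le> y \<Longrightarrow> N x \<le> N y"
    and "N 0 = 0"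
proof -
  show L: "vector_sublattice L"
    using assms unfolding normed_lattice_def by blast
  show "0 \<le> N x" if "x \<in> L" for x
    using assms that unfolding normed_lattice_def by blast
  show "N (c *\<^sub>R x) = \<bar>c\<bar> * N x" if "x \<in> L" for x c
    using assms that unfolding normed_lattice_def by blast
  show "N (x + y) \<le> N x + N y" if "x \<in> L" "y \<in> L" for x y
    using assms that unfolding normed_lattice_def by blast
  show "N x \<le> N y" if "x \<in> L" "y \<in> L" "0 \<le> x" "x \<le> y" for x y
  proof -
    have "\<bar>x\<bar> \<le> \<bar>y\<bar>"
      using that order_trans[of 0 x y] by simp
    then show ?thesis
      using assms that unfolding normed_lattice_def by blast
  qed
  show "N 0 = 0"
    using assms vector_sublattice_closed(1)[OF L] unfolding normed_lattice_def by blast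
qed

lemma normed_lattice_dist_triangle:
  assumes N: "normed_lattice L N" and "x \<in> L" "y \<in> L" "l \<in> L"
  shows "N (x - y) \<le> N (x - l) + N (y - l)"
proof -
  have mem: "x - l \<in> L" "y - l \<in> L" "l - y \<in> L"
    using assms vector_sublattice_closed(3)[OF normed_latticeD(1)[OF N]] by blast+
  have "N (l - y) = N (y - l)"
    using normed_latticeD(3)[OF N mem(2), of "-1"] by simp
  then show ?thesis
    using normed_latticeD(4)[OF N mem(1,3)] by simp
qed

text \<open>The given majorant ensures that the infimum of reals defining \<open>upper_norm\<close>
  is over a non-empty set.\<close>

lemma upper_norm_greatest:
  assumes "y \<in> E" "\<bar>x\<bar> \<le> y" and "\<And>y. y \<in> E \<Longrightarrow> 0 \<le> y \<Longrightarrow> \<bar>x\<bar> \<le> y \<Longrightarrow> c \<le> N y"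
  shows "c \<le> upper_norm E N x"
  unfolding upper_norm_def
proof (rule cInf_greatest)
  have "0 \<le> y"
    using assms(2) abs_ge_zero order_trans by blast
  then show "N ` {y \<in> E. 0 \<le> y \<and> \<bar>x\<bar> \<le> y} \<noteq> {}"
    using assms(1,2) by blast
qed (use assms(3) in auto)

lemma upper_norm_eq:
  assumes N: "normed_lattice E N" and x: "x \<in> E" "0 \<le> x"
  shows "upper_norm E N x = N x"
  unfolding upper_norm_def
  using x by (intro cInf_eq_minimum) (auto intro: normed_latticeD(5)[OF N])

section \<open>Boundedness forced by convergence along increasing sequences\<close>

text \<open>
  If \<open>T\<close> were unbounded, the partial sums of suitable \<open>u n \<ge> 0\<close> with \<open>N (u n) \<le> (1/2)\<^sup>n\<close> and
  \<open>NF (T (u n)) = 1\<close> would violate the convergence hypothesis.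
\<close>

lemma convergence_imp_bounded_operator:
  fixes E :: "'a::vector_lattice set" and F :: "'b::vector_lattice set"
  assumes N: "normed_lattice E N" and NF: "normed_lattice F NF" and T: "positive_operator E F T"
    and conv: "\<And>xs :: nat \<Rightarrow> 'a. (\<And>n. xs n \<in> E \<and> 0 \<le> xs n) \<Longrightarrow> incseq xs \<Longrightarrow> \<exists>M. \<forall>n. N (xs n) \<le> M \<Longrightarrow>
      \<exists>l\<in>F. (\<lambda>n. NF (T (xs n) - l)) \<longlonglongrightarrow> 0"
  shows "\<exists>C. \<forall>x\<in>E. 0 \<le> x \<longrightarrow> NF (T x) \<le> C * N x"
proof (rule ccontr)
  assume "\<not> ?thesis"
  \<comment> \<open>The failure of a bound is used with \<open>C = 2 ^ n\<close>, which makes the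
    normalised elements summable in norm.\<close>
  then have "\<exists>x\<in>E. 0 \<le> x \<and> 2 ^ n * N x < NF (T x)" for n
    by (auto simp: not_le)
  then obtain x where x: "\<And>n. x n \<in> E" "\<And>n. 0 \<le> x n" "\<And>n. 2 ^ n * N (x n) < NF (T (x n))"
    by metis
  note E = normed_latticeD(1)[OF N]
  note Ec = vector_sublattice_closed[OF E]
  note T_simps = positive_operator_simps[OF T E]
  define u where "u n = (1 / NF (T (x n))) *\<^sub>R x n" for n
  have pos: "0 < NF (T (x n))" for n
    using x(3)[of n] normed_latticeD(2)[OF N x(1)[of n]]
    by (meson le_less_trans mult_nonneg_nonneg zero_le_numeral zero_le_power)
  have u: "u n \<in> E" "0 \<le> u n" for n
    unfolding u_def using x(1,2)[of n] pos[of n] Ec(5) by (auto intro: scaleR_nonneg_nonneg)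
  have Nu: "N (u n) \<le> (1/2) ^ n" for n
    unfolding u_def normed_latticeD(3)[OF N x(1)]
    using x(3)[of n] pos[of n] by (simp add: power_one_over field_simps)
  have Tu: "NF (T (u n)) = 1" for n
    unfolding u_def T_simps(3)[OF x(1)] normed_latticeD(3)[OF NF T_simps(1)[OF x(1)]]
    using pos[of n] by simp
  define s where "s n = (\<Sum>k<n. u k)" for n
  have s_Suc: "s (Suc n) = s n + u n" for n
    unfolding s_def by simp
  have s: "s n \<in> E \<and> 0 \<le> s n \<and> N (s n) \<le> (\<Sum>k<n. (1/2) ^ k)" for n
  proof (induction n)
    case 0
    then show ?case
      using Ec(1) normed_latticeD(6)[OF N] by (simp add: s_def)
  next
    case (Suc n)
    then have "N (s (Suc n)) \<le> N (s n) + N (u n)"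
      unfolding s_Suc using u normed_latticeD(4)[OF N] by blast
    then show ?case
      using Suc Nu[of n] u[of n] Ec(2)[of "s n" "u n"] by (simp add: s_Suc)
  qed
  have "N (s n) \<le> 2" for n
  proof -
    have "(\<Sum>k<n. (1/2::real) ^ k) = 2 - 2 * (1/2) ^ n"
      by (induction n) simp_all
    then show ?thesis
      using s[of n] zero_le_power[of "1/2::real" n] by linarith
  qed
  moreover have "incseq s"
    using u(2) s_Suc by (intro incseq_SucI) simp
  ultimately obtain l where l: "l \<in> F" "(\<lambda>n. NF (T (s n) - l)) \<longlonglongrightarrow> 0"
    using conv[of s] s by blast
  \<comment> \<open>Consecutive images differ by \<open>T (u n)\<close>, of norm \<open>1\<close>,
    so they cannot both come arbitrarily close to \<open>l\<close>.\<close>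
  have "1 \<le> NF (T (s (Suc n)) - l) + NF (T (s n) - l)" for n
  proof -
    have "T (s (Suc n)) - T (s n) = T (u n)"
      unfolding s_Suc using T_simps(2) s u by auto
    then show ?thesis
      using normed_lattice_dist_triangle[OF NF T_simps(1) T_simps(1) l(1), of "s (Suc n)" "s n"] s Tu
      by simp
  qed
  moreover have "(\<lambda>n. NF (T (s (Suc n)) - l) + NF (T (s n) - l)) \<longlonglongrightarrow> 0 + 0"
    using l(2) by (intro tendsto_add) (rule LIMSEQ_Suc)
  ultimately have "(1::real) \<le> 0 + 0"
    by (intro LIMSEQ_le_const[of _ "0 + 0" 1]) auto
  then show False
    by simp
qed

section \<open>Norm convergence along increasing bounded sequences\<close>

context positive_extension
begin

text \<open>Each \<open>xs n\<close> is replaced by some \<open>w n\<close> in \<open>E\<close>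
  below it, with the \<open>w n\<close> increasing and \<open>xs n - w n\<close> dominated by an
  element of \<open>E\<close> of norm below \<open>(1/2) ^ n\<close>. Boundedness of
  \<open>T\<close> makes \<open>Tt (xs n) - T (w n)\<close> tend to zero in norm, so both sequences
  have the same limit.\<close>

lemma sequence_condition_extension:
  assumes N: "normed_lattice E N" and NF: "normed_lattice F NF" and oc: "order_continuous_norm E N"
    and conv: "\<And>xs :: nat \<Rightarrow> 'a. (\<And>n. xs n \<in> E \<and> 0 \<le> xs n) \<Longrightarrow> incseq xs \<Longrightarrow> \<exists>M. \<forall>n. N (xs n) \<le> M \<Longrightarrow>
      \<exists>l\<in>F. (\<lambda>n. NF (T (xs n) - l)) \<longlonglongrightarrow> 0"
    and xs: "\<And>n. xs n \<in> Et" "\<And>n. 0 \<le> xs n" "incseq xs" "\<And>n. upper_norm E N (xs n) \<le> M"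
  shows "\<exists>l\<in>F. (\<lambda>n. NF (Tt (xs n) - l)) \<longlonglongrightarrow> 0"
proof -
  note Ec = vector_sublattice_closed[OF E]
  have T: "positive_operator E F T"
    unfolding positive_operator_def linear_operator_def
  proof (intro conjI ballI allI impI)
    fix x y c assume x: "x \<in> E"
    then have xt: "x \<in> Et"
      using E_sub by blast
    show "T x \<in> F"
      using Tt_simps(1)[OF xt] ext[OF x] by simp
    show "T (c *\<^sub>R x) = c *\<^sub>R T x"
      using Tt_simps(3)[OF xt] ext[OF x] ext[OF Ec(5)[OF x]] by simp
    show "0 \<le> T x" if "0 \<le> x"
      using Tt_simps(7)[OF xt that] ext[OF x] by simp
    assume y: "y \<in> E"
    then have "y \<in> Et"
      using E_sub by blast
    then show "T (x + y) = T x + T y"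
      using Tt_simps(2)[OF xt] ext[OF x] ext[OF y] ext[OF Ec(2)[OF x y]] by simp
  qed
  obtain C where C: "\<And>x. x \<in> E \<Longrightarrow> 0 \<le> x \<Longrightarrow> NF (T x) \<le> C * N x"
    using convergence_imp_bounded_operator[OF N NF T conv] by blast
  have "\<exists>y z. y \<in> E \<and> z \<in> E \<and> xs n \<le> y \<and> 0 \<le> z \<and> z \<le> xs n \<and> N (y - z) < (1/2) ^ n" for n
  proof -
    let ?D = "{y - z |y z. y \<in> E \<and> z \<in> E \<and> xs n \<le> y \<and> 0 \<le> z \<and> z \<le> xs n}"
    have net: "net_decreases_to E ?D {(u, v) \<in> ?D \<times> ?D. v \<le> u} (\<lambda>u. u) 0"
      by (intro down_to_zero_net gap_down_to_zero xs(2))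
    have "(0::real) < (1/2) ^ n"
      by simp
    from order_continuous_normD[OF oc net this] obtain d where
      "d \<in> ?D" "\<And>a. a \<in> ?D \<Longrightarrow> (d, a) \<in> {(u, v) \<in> ?D \<times> ?D. v \<le> u} \<Longrightarrow> N a < (1/2) ^ n"
      by blast
    \<comment> \<open>The index \<open>d\<close> belongs to its own tail.\<close>
    then have "d \<in> ?D" "N d < (1/2) ^ n"
      by simp_all
    then show ?thesis
      by blast
  qed
  then obtain y z where yz: "\<And>n. y n \<in> E" "\<And>n. z n \<in> E" "\<And>n. xs n \<le> y n" "\<And>n. 0 \<le> z n"
    "\<And>n. z n \<le> xs n" "\<And>n. N (y n - z n) < (1/2) ^ n"
    by metis
  \<comment> \<open>The \<open>z n\<close> need not increase; their running suprema do, and they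
    stay below \<open>xs n\<close> because \<open>xs\<close> increases.\<close>
  define w where "w = rec_nat (z 0) (\<lambda>n v. sup v (z (Suc n)))"
  have w_simps: "w 0 = z 0" "w (Suc n) = sup (w n) (z (Suc n))" for n
    unfolding w_def by simp_all
  have w: "w n \<in> E \<and> z n \<le> w n \<and> w n \<le> xs n" for n
  proof (induction n)
    case 0
    then show ?case
      using yz w_simps by simp
  next
    case (Suc n)
    moreover have "xs n \<le> xs (Suc n)"
      using xs(3) by (rule incseq_SucD)
    ultimately show ?case
      using yz(2,5)[of "Suc n"] Ec(6) w_simps(2) by (auto intro: order_trans)
  qed
  have w0: "0 \<le> w n" for n
    using w[of n] yz(4)[of n] by (blast intro: order_trans)
  have "incseq w"
    by (intro incseq_SucI) (simp add: w_simps)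
  moreover have "N (w n) \<le> M" for n
  proof -
    have abs: "\<bar>xs n\<bar> = xs n"
      using xs(2) by simp
    \<comment> \<open>Every majorant of \<open>xs n\<close> in \<open>E\<close> also majorizes
      \<open>w n\<close>, so the bound \<open>M\<close> carries over to the
      \<open>w n\<close>.\<close>
    have "N (w n) \<le> upper_norm E N (xs n)"
    proof (rule upper_norm_greatest)
      show "y n \<in> E" "\<bar>xs n\<bar> \<le> y n"
        using yz abs by simp_all
      show "N (w n) \<le> N v" if "v \<in> E" "0 \<le> v" "\<bar>xs n\<bar> \<le> v" for v
        using that w[of n] w0[of n] abs by (intro normed_latticeD(5)[OF N]) (auto intro: order_trans)
    qed
    then show ?thesis
      using xs(4)[of n] by linarith
  qed
  ultimately obtain l where l: "l \<in> F" "(\<lambda>n. NF (T (w n) - l)) \<longlonglongrightarrow> 0"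
    using conv[of w] w w0 by blast
  have bound: "NF (Tt (xs n) - l) \<le> \<bar>C\<bar> * (1/2) ^ n + NF (T (w n) - l)" for n
  proof -
    have mem: "w n \<in> Et" "y n \<in> Et" "z n \<in> Et" "xs n \<in> Et"
      using w yz xs(1) E_sub by auto
    have d: "xs n - w n \<in> Et" "y n - z n \<in> E" "y n - z n \<in> Et"
      using mem Et_closed(3) yz Ec(3) by auto
    have le: "0 \<le> xs n - w n" "xs n - w n \<le> y n - z n"
      using w yz by (auto intro: diff_mono)
    have le0: "0 \<le> y n - z n"
      using le by (rule order_trans)
    have "NF (Tt (xs n - w n)) \<le> NF (Tt (y n - z n))"
      using d le by (intro normed_latticeD(5)[OF NF] Tt_simps(1,7,8))
    also have "\<dots> \<le> C * N (y n - z n)"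
      using C[OF d(2) le0] ext[OF d(2)] by simp
    \<comment> \<open>The sign of \<open>C\<close> is unknown; \<open>\<bar>C\<bar>\<close> keeps
      the product monotone in its second factor.\<close>
    also have "\<dots> \<le> \<bar>C\<bar> * (1/2) ^ n"
      using yz(6)[of n] normed_latticeD(2)[OF N d(2)] by (intro mult_mono) auto
    finally have 1: "NF (Tt (xs n) - T (w n)) \<le> \<bar>C\<bar> * (1/2) ^ n"
      using Tt_simps(5)[OF mem(4,1)] ext w by simp
    have F': "Tt (xs n) - T (w n) \<in> F" "T (w n) - l \<in> F"
      using Tt_simps(1) mem ext w l(1) F_closed(3) by metis+
    show ?thesis
      using normed_latticeD(4)[OF NF F'] 1 by simp
  qed
  have lim: "(\<lambda>n. \<bar>C\<bar> * (1/2) ^ n + NF (T (w n) - l)) \<longlonglongrightarrow> 0"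
    using tendsto_add[OF tendsto_mult_right_zero[OF LIMSEQ_power_zero[of "1/2::real"], of "\<bar>C\<bar>"] l(2)]
    by simp
  have "(\<lambda>n. NF (Tt (xs n) - l)) \<longlonglongrightarrow> 0"
  proof (rule tendsto_sandwich[OF _ _ tendsto_const lim])
    show "\<forall>\<^sub>F n in sequentially. 0 \<le> NF (Tt (xs n) - l)"
      using Tt_simps(1)[OF xs(1)] l(1) F_closed(3) normed_latticeD(2)[OF NF] by (intro always_eventually) blast
  qed (use bound in auto)
  then show ?thesis
    using l(1) by blast
qed

text \<open>The direction back to \<open>E\<close> is restriction: on positive elements of
  \<open>E\<close> the upper norm is \<open>N\<close>, and \<open>Tt\<close> agrees with
  \<open>T\<close>.\<close>

lemma sequence_condition_iff:
  assumes N: "normed_lattice E N" and NF: "normed_lattice F NF" and oc: "order_continuous_norm E N"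
  shows "(\<forall>xs :: nat \<Rightarrow> 'a.
            (\<forall>n. xs n \<in> E \<and> 0 \<le> xs n) \<and> incseq xs \<and> (\<exists>M. \<forall>n. N (xs n) \<le> M)
            \<longrightarrow> (\<exists>l\<in>F. (\<lambda>n. NF (T (xs n) - l)) \<longlonglongrightarrow> 0))
     \<longleftrightarrow> (\<forall>xs :: nat \<Rightarrow> 'a.
            (\<forall>n. xs n \<in> Et \<and> 0 \<le> xs n) \<and> incseq xs \<and> (\<exists>M. \<forall>n. upper_norm E N (xs n) \<le> M)
            \<longrightarrow> (\<exists>l\<in>F. (\<lambda>n. NF (Tt (xs n) - l)) \<longlonglongrightarrow> 0))"
    (is "?P \<longleftrightarrow> ?Q")
proof
  assume P: ?P
  then have conv: "\<exists>l\<in>F. (\<lambda>n. NF (T (xs n) - l)) \<longlonglongrightarrow> 0"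
    if "\<And>n. xs n \<in> E \<and> 0 \<le> xs n" "incseq xs" "\<exists>M. \<forall>n. N (xs n) \<le> M" for xs :: "nat \<Rightarrow> 'a"
    using that by blast
  show ?Q
  proof (intro allI impI, elim conjE exE)
    fix xs :: "nat \<Rightarrow> 'a" and M
    assume "\<forall>n. xs n \<in> Et \<and> 0 \<le> xs n" "incseq xs" "\<forall>n. upper_norm E N (xs n) \<le> M"
    then show "\<exists>l\<in>F. (\<lambda>n. NF (Tt (xs n) - l)) \<longlonglongrightarrow> 0"
      by (intro sequence_condition_extension[OF N NF oc conv]) auto
  qed
next
  assume Q: ?Q
  show ?P
  proof (intro allI impI, elim conjE exE)
    fix xs :: "nat \<Rightarrow> 'a" and M
    assume xs: "\<forall>n. xs n \<in> E \<and> 0 \<le> xs n" "incseq xs" "\<forall>n. N (xs n) \<le> M"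
    have "(\<forall>n. xs n \<in> Et \<and> 0 \<le> xs n) \<and> (\<forall>n. upper_norm E N (xs n) \<le> M)"
      using xs E_sub upper_norm_eq[OF N] by auto
    then have "\<exists>l\<in>F. (\<lambda>n. NF (Tt (xs n) - l)) \<longlonglongrightarrow> 0"
      using Q xs(2) by blast
    then show "\<exists>l\<in>F. (\<lambda>n. NF (T (xs n) - l)) \<longlonglongrightarrow> 0"
      using xs(1) ext by simp
  qed
qed

end

text \<open>The ambient lattice is the whole type. Part 3 has its own operators \<open>S\<close> and
  \<open>St\<close>, since its codomain is \<open>E\<close>, and it asks \<open>E\<close> to be
  Dedekind complete because \<open>E\<close> takes the place of \<open>F\<close> there.\<close>

theorem theorem6:
  fixes E Et :: "'g::vector_lattice set" and N :: "'g \<Rightarrow> real"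
    and F :: "'f::vector_lattice set" and NF :: "'f \<Rightarrow> real"
    and T Tt :: "'g \<Rightarrow> 'f"
  assumes "archimedean_on (UNIV :: 'g set)"
    and "normed_lattice E N"
    and "order_dense E UNIV" and "majorizing E UNIV"
    and "norm_extension_lattice E N UNIV Et"
    and "normed_lattice F NF" and "archimedean_on F" and "dedekind_complete_on F"
    and "positive_operator E F T" and "T \<in> order_continuous_operators E F"
    and "operator_extension E Et F T Tt"
  shows
    "(\<forall>(A :: 'i set) r xs x.
        x \<in> Et \<and> 0 \<le> x \<and> (\<forall>a\<in>A. xs a \<in> E \<and> 0 \<le> xs a) \<and> net_decreases_to Et A r xs x
        \<longrightarrow> net_decreases_to F A r (\<lambda>a. T (xs a)) (Tt x))
   \<and> ((\<forall>x\<in>E. \<forall>y\<in>E. 0 \<le> x \<and> 0 \<le> y \<longrightarrow> T (inf x y) = inf (T x) (T y))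
        \<longrightarrow> lattice_homomorphism Et F Tt \<and> Tt \<in> order_continuous_operators Et F)
   \<and> (dedekind_complete_on E \<longrightarrow>
        (\<forall>S St :: 'g \<Rightarrow> 'g.
           positive_operator E E S \<and> S \<in> order_continuous_operators E E \<and>
           operator_extension E Et E S St \<and> band_preserving E S
           \<longrightarrow> band_preserving Et St))
   \<and> (preserves_disjointness E T \<longrightarrow> preserves_disjointness Et Tt)
   \<and> (order_continuous_norm E N \<longrightarrow>
        ((\<forall>xs :: nat \<Rightarrow> 'g.
            (\<forall>n. xs n \<in> E \<and> 0 \<le> xs n) \<and> incseq xs \<and> (\<exists>M. \<forall>n. N (xs n) \<le> M)
            \<longrightarrow> (\<exists>l\<in>F. (\<lambda>n. NF (T (xs n) - l)) \<longlonglongrightarrow> 0))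
         \<longleftrightarrow>
         (\<forall>xs :: nat \<Rightarrow> 'g.
            (\<forall>n. xs n \<in> Et \<and> 0 \<le> xs n) \<and> incseq xs \<and> (\<exists>M. \<forall>n. upper_norm E N (xs n) \<le> M)
            \<longrightarrow> (\<exists>l\<in>F. (\<lambda>n. NF (Tt (xs n) - l)) \<longlonglongrightarrow> 0))))"
proof (intro conjI impI)
  have E: "vector_sublattice E" and F: "vector_sublattice F"
    using assms(2,6) by (auto intro: normed_latticeD(1))
  have Et: "vector_sublattice Et" "E \<subseteq> Et"
    using assms(5) unfolding norm_extension_lattice_def by auto
  have ext: "Tt x = T x" if "x \<in> E" for x
    using assms(11) that unfolding operator_extension_def by blast
  interpret positive_extension E Et F T Tt
    using assms(1,3,4,10) E F Et ext positive_operator_extension[OF assms(9) E F Et(1) assms(11)]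
    by unfold_locales auto
  show "\<forall>(A :: 'i set) r xs x.
        x \<in> Et \<and> 0 \<le> x \<and> (\<forall>a\<in>A. xs a \<in> E \<and> 0 \<le> xs a) \<and> net_decreases_to Et A r xs x
        \<longrightarrow> net_decreases_to F A r (\<lambda>a. T (xs a)) (Tt x)"
  proof (intro allI impI, elim conjE)
    fix A :: "'i set" and r xs x
    assume xs: "\<forall>a\<in>A. xs a \<in> E \<and> 0 \<le> xs a" and net: "net_decreases_to Et A r xs x"
    have "(\<lambda>a. Tt (xs a)) ` A = (\<lambda>a. T (xs a)) ` A"
      using xs ext by (intro image_cong) auto
    then show "net_decreases_to F A r (\<lambda>a. T (xs a)) (Tt x)"
      using extension_net_decreases[OF net] xs ext unfolding net_decreases_to_def by simp
  qed
  show "lattice_homomorphism Et F Tt"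
    if "\<forall>x\<in>E. \<forall>y\<in>E. 0 \<le> x \<and> 0 \<le> y \<longrightarrow> T (inf x y) = inf (T x) (T y)"
    using that by (intro extension_lattice_homomorphism) blast
  show "Tt \<in> order_continuous_operators Et F"
    by (rule extension_order_continuous)
  show "\<forall>S St :: 'g \<Rightarrow> 'g.
           positive_operator E E S \<and> S \<in> order_continuous_operators E E \<and>
           operator_extension E Et E S St \<and> band_preserving E S
           \<longrightarrow> band_preserving Et St" if "dedekind_complete_on E"
  proof -
    have E_UNIV: "E = UNIV"
      using that by (rule dedekind_complete_imp_UNIV)
    then have "Et = UNIV"
      using E_sub by blast
    \<comment> \<open>With \<open>E\<close> the whole space, the extension has nothing to extend and
      the bands of \<open>E\<close> and \<open>Et\<close> coincide.\<close>
    moreover have "St = S" if "operator_extension E Et E S St" for S St :: "'g \<Rightarrow> 'g"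
      using that unfolding operator_extension_def E_UNIV by blast
    ultimately show ?thesis
      using E_UNIV by blast
  qed
  show "preserves_disjointness Et Tt" if "preserves_disjointness E T"
    using that by (rule extension_preserves_disjointness)
  show "(\<forall>xs :: nat \<Rightarrow> 'g.
            (\<forall>n. xs n \<in> E \<and> 0 \<le> xs n) \<and> incseq xs \<and> (\<exists>M. \<forall>n. N (xs n) \<le> M)
            \<longrightarrow> (\<exists>l\<in>F. (\<lambda>n. NF (T (xs n) - l)) \<longlonglongrightarrow> 0))
         \<longleftrightarrow>
         (\<forall>xs :: nat \<Rightarrow> 'g.
            (\<forall>n. xs n \<in> Et \<and> 0 \<le> xs n) \<and> incseq xs \<and> (\<exists>M. \<forall>n. upper_norm E N (xs n) \<le> M)
            \<longrightarrow> (\<exists>l\<in>F. (\<lambda>n. NF (Tt (xs n) - l)) \<longlonglongrightarrow> 0))"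
    if "order_continuous_norm E N"
    by (rule sequence_condition_iff[OF assms(2,6) that])
qed

end
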